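(* Let $1 \le d \le D$ be integers, let $\mathbf{A} \in \mathbb{R}^{D \times d}$ be such that every $d\times d$ submatrix extracted from $\mathbf{A}$ by selecting $d$ rows is invertible, and let $\mathbf{B} \in \mathbb{R}^{d \times D}$ be a matrix whose rows form an orthonormal basis of $\mathrm{Ran}(\mathbf{A})$. Then $\mathcal{Z}$ is the smallest closed set $\mathcal{Y} \subseteq \mathbb{R}^d$, among those contained in the domain $\mathcal{Z}$ of $\gamma$, such that $\gamma(\mathcal{Y}) = \mathcal{E}$. Furthermore, $\mathcal{Z}$ is a compact, convex and centrally symmetric set.
   Context: $\mathcal{X} = [-1,1]^D \subset \mathbb{R}^D$, and for a nonempty closed convex set $C \subseteq \mathbb{R}^D$, $p_C$ denotes the convex projection onto $C$ (Euclidean nearest-point map). $\mathcal{E} = \{p_{\mathcal{X}}(\mathbf{A}\mathbf{y}) : \mathbf{y} \in \mathbb{R}^d\}$. $\mathrm{Ran}(\mathbf{A}) \subseteq \mathbb{R}^D$ is the column space of $\mathbf{A}$, and $p_{\mathbf{A}} = \mathbf{B}^\top\mathbf{B}$ is the orthogonal projection of $\mathbb{R}^D$ onto it (here $\mathbf{B}\mathbf{B}^\top = \mathbf{I}_d$). $\mathcal{Z} = \mathbf{B}\mathcal{X} = \{\mathbf{B}\mathbf{x} : \mathbf{x} \in \mathcal{X}\} \subset \mathbb{R}^d$. For $\mathbf{a} \in \mathbb{R}^D$ let $p_{\mathbf{A}}^{-1}(\mathbf{a}) = \{\mathbf{x} \in \mathbb{R}^D : p_{\mathbf{A}}(\mathbf{x})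 = \mathbf{a}\}$. The map $\gamma : \mathcal{Z} \to \mathbb{R}^D$ is defined by $$\gamma(\mathbf{y}) = p_{\mathcal{X} \cap p_{\mathbf{A}}^{-1}(\mathbf{B}^\top \mathbf{y})}(\mathbf{B}^\top \mathbf{y}),$$ where $\mathcal{X} \cap p_{\mathbf{A}}^{-1}(\mathbf{B}^\top \mathbf{y})$ is a nonempty closed convex set because $\mathbf{y} \in \mathcal{Z}$; equivalently, $\gamma(\mathbf{y})$ is the minimizer of $\|\mathbf{x} - \mathbf{B}^\top\mathbf{y}\|^2$ over $\mathbf{x} \in \mathcal{X}$ subject to $\mathbf{B}\mathbf{x} = \mathbf{y}$. "Smallest closed set with a property" means: the set is closed, has the property, and is contained in every closed set having the property. Centrally symmetric means $-\mathcal{Z} = \mathcal{Z}$ (center at the origin). *)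

theory Defs
  imports "HOL-Analysis.Analysis"
begin

text \<open>
  The dimensions \<open>d\<close> and \<open>D\<close> are \<open>CARD('d)\<close> and \<open>CARD('D)\<close>. A matrix with
  \<open>m\<close> rows and \<open>n\<close> columns has type \<open>real ^ 'n ^ 'm\<close>.
\<close>

definition box_X :: "(real ^ 'D) set" where
  "box_X = {x. \<forall>i. -1 \<le> x $ i \<and> x $ i \<le> 1}"

definition Ran :: "real ^ 'd ^ 'D \<Rightarrow> (real ^ 'D) set" where
  "Ran A = range (\<lambda>y. A *v y)"

definition set_E :: "real ^ 'd ^ 'D \<Rightarrow> (real ^ 'D) set" where
  "set_E A = {closest_point box_X (A *v y) | y. True}"

text \<open>
  The selection of \<open>d\<close> rows is an injection \<open>s\<close> from row indices of the submatrix to row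
  indices of \<open>A\<close>; all orderings of the selected rows occur, which does not affect
  invertibility.
\<close>

definition all_row_submatrices_invertible :: "real ^ 'd ^ 'D \<Rightarrow> bool" where
  "all_row_submatrices_invertible A \<longleftrightarrow>
     (\<forall>s :: 'd \<Rightarrow> 'D. inj s \<longrightarrow> invertible (\<chi> i j. A $ s i $ j))"

text \<open>Orthonormality is stated for the indexed family of rows, so repeated rows are excluded.\<close>

definition rows_orthonormal_basis :: "real ^ 'D ^ 'd \<Rightarrow> (real ^ 'D) set \<Rightarrow> bool" where
  "rows_orthonormal_basis B V \<longleftrightarrow>
     (\<forall>i j. row i B \<bullet> row j B = (if i = j then 1 else 0)) \<and> span (rows B) = V"

text \<open>
  On a linear subspace the nearest-point map is the orthogonal projection; the lemma below
  gives its matrix form.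
\<close>

definition proj_A :: "real ^ 'd ^ 'D \<Rightarrow> real ^ 'D \<Rightarrow> real ^ 'D" where
  "proj_A A = closest_point (Ran A)"

lemma proj_A_matrix:
  fixes A :: "real ^ 'd ^ 'D" and B :: "real ^ 'D ^ 'd"
  assumes "rows_orthonormal_basis B (Ran A)"
  shows "B ** transpose B = mat 1" and "proj_A A x = (transpose B ** B) *v x"
proof -
  have on: "row i B \<bullet> row j B = (if i = j then 1 else 0)" for i j
    using assms by (auto simp: rows_orthonormal_basis_def)
  show BB: "B ** transpose B = mat 1"
    using on by (simp add: vec_eq_iff matrix_matrix_mult_def transpose_def mat_def row_def
        inner_vec_def)
  let ?p = "(transpose B ** B) *v x"
  have sp: "span (rows B) = Ran A"
    using assms by (auto simp: rows_orthonormal_basis_def)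
  have Bp: "B *v ?p = B *v x"
    by (simp add: matrix_vector_mul_assoc matrix_mul_assoc BB)
  have p_in: "?p \<in> Ran A"
  proof -
    have "?p = transpose B *v (B *v x)"
      by (simp add: matrix_vector_mul_assoc)
    then show ?thesis
      using matrix_vector_mult_in_columnspace[of "transpose B" "B *v x"] sp
      by (simp add: columns_transpose)
  qed
  have row_mult: "row i B \<bullet> v = (B *v v) $ i" for i v
    by (simp add: row_def matrix_vector_mult_def inner_vec_def)
  have orth: "orthogonal (x - ?p) z" if "z \<in> Ran A" for z
  proof (rule orthogonal_to_span)
    show "z \<in> span (rows B)" using that sp by simp
    fix r assume "r \<in> rows B"
    then obtain i where r: "r = row i B" by (auto simp: rows_def)
    have "r \<bullet> (x - ?p) = (B *v x) $ i - (B *v ?p) $ i"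
      unfolding r by (simp only: inner_diff_right row_mult)
    then show "orthogonal (x - ?p) r"
      unfolding Bp by (simp add: orthogonal_def inner_commute)
  qed
  have sub: "subspace (Ran A)"
    using sp by (metis subspace_span)
  have "dist x ?p \<le> dist x z" if "z \<in> Ran A" for z
  proof -
    have "?p - z \<in> Ran A" using sub p_in that by (rule subspace_diff)
    then have "orthogonal (x - ?p) (?p - z)" by (rule orth)
    then have "(norm ((x - ?p) + (?p - z)))\<^sup>2 = (norm (x - ?p))\<^sup>2 + (norm (?p - z))\<^sup>2"
      by (rule norm_add_Pythagorean)
    then have "(norm (x - ?p))\<^sup>2 \<le> (norm (x - z))\<^sup>2" by simp
    then show ?thesis by (simp add: dist_norm power2_le_iff_abs_le)
  qed
  then show "proj_A A x = ?p"
    unfolding proj_A_def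
    using closest_point_unique[OF subspace_imp_convex[OF sub] closed_subspace[OF sub] p_in]
    by metis
qed

definition set_Z :: "real ^ 'D ^ 'd \<Rightarrow> (real ^ 'd) set" where
  "set_Z B = (\<lambda>x. B *v x) ` box_X"

text \<open>
  \<open>gamma A B\<close> is meaningful on \<open>set_Z B\<close> only: elsewhere the set projected onto is empty.
\<close>

definition gamma :: "real ^ 'd ^ 'D \<Rightarrow> real ^ 'D ^ 'd \<Rightarrow> real ^ 'd \<Rightarrow> real ^ 'D" where
  "gamma A B y =
     closest_point (box_X \<inter> {x. proj_A A x = transpose B *v y}) (transpose B *v y)"

definition smallest_closed_set_with ::
    "('a::topological_space set \<Rightarrow> bool) \<Rightarrow> 'a set \<Rightarrow> bool" where
  "smallest_closed_set_with P S \<longleftrightarrow>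
     closed S \<and> P S \<and> (\<forall>T. closed T \<and> P T \<longrightarrow> S \<subseteq> T)"

definition centrally_symmetric :: "'a::real_vector set \<Rightarrow> bool" where
  "centrally_symmetric S \<longleftrightarrow> uminus ` S = S"

end

theory Submission imports Defs begin

text \<open>
  Write \<open>X\<close> for the box and \<open>V\<close> for the column space of \<open>A\<close>, which the rows of \<open>B\<close> span.
  On the fibre \<open>{x. B *v x = y}\<close> Pythagoras gives
  \<open>(norm (x - transpose B *v y))\<^sup>2 = (norm x)\<^sup>2 - (norm y)\<^sup>2\<close>, so \<open>gamma A B y\<close> is the point of least
  norm of \<open>X\<close> above \<open>y\<close> (\<open>gamma_least_norm\<close>). The image of \<open>gamma A B\<close> is thus the set of those
  \<open>x \<in> X\<close> that have least norm among the points of \<open>X\<close> with the same \<open>B\<close>-image.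

  This set is also \<open>set_E A\<close>, the set of points of \<open>X\<close> that are nearest to some point of \<open>V\<close>: this is
  quadratic programming duality (\<open>closest_point_image_span\<close>). A point \<open>x\<close> is nearest to \<open>u \<in> V\<close> iff
  \<open>u - x\<close> is in the normal cone of \<open>X\<close> at \<open>x\<close>; the coordinates of \<open>u\<close> with respect to the rows of
  \<open>B\<close> are Lagrange multipliers for the constraint \<open>B *v z = B *v x\<close>. Multipliers exist for every
  minimizer, even when \<open>y\<close> is on the boundary of \<open>set_Z B\<close> and its fibre misses the interior of \<open>X\<close>,
  because \<open>X\<close> is polyhedral: all cones in question are finitely generated, hence closed, and
  Farkas' lemma (\<open>farkas_convex_cone_hull\<close>) holds.

  Hence \<open>gamma A B\<close> maps \<open>set_Z B\<close> onto \<open>set_E A\<close>. It is injective there, with left inverse \<open>B\<close>, so no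
  proper subset of \<open>set_Z B\<close> has the same image; this is minimality. The geometric properties of
  \<open>set_Z B\<close> are inherited from the box, of which it is a linear image.
\<close>

section \<open>Separation and feasible directions\<close>

text \<open>
  A finitely generated cone is closed, so a hyperplane strictly separates it from an outside point.
  Since a cone is stable under scaling, the functional cannot be negative anywhere on it.
\<close>

lemma farkas_convex_cone_hull:
  fixes G :: "'a::euclidean_space set"
  assumes "finite G" "x \<notin> convex_cone hull G"
  obtains v where "v \<bullet> x < 0" "\<And>g. g \<in> G \<Longrightarrow> 0 \<le> v \<bullet> g"
proof -
  obtain v b where vx: "v \<bullet> x < b" and vK: "\<And>k. k \<in> convex_cone hull G \<Longrightarrow> b < v \<bullet> k"
    using separating_hyperplane_closed_point
      [OF convex_convex_cone_hull closed_convex_cone_hull[OF assms(1)] assms(2)]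
    by blast
  have b: "b < 0"
    using vK[OF convex_cone_hull_contains_0] by simp
  have "0 \<le> v \<bullet> g" if "g \<in> G" for g
  proof (rule ccontr)
    assume neg: "\<not> 0 \<le> v \<bullet> g"
    \<comment> \<open>The multiple of \<open>g\<close> on which the separating functional takes exactly the value \<open>b\<close>.\<close>
    have "(b / (v \<bullet> g)) *\<^sub>R g \<in> convex_cone hull G"
      using that b neg by (intro convex_cone_hull_mul hull_inc divide_nonpos_neg) auto
    from vK[OF this] show False
      using neg by simp
  qed
  with vx b show thesis
    by (intro that[of v]) auto
qed

text \<open>
  Only the active constraints restrict the direction: the others have slack, which a short step
  does not use up. Finiteness of the family gives a common step length.
\<close>

lemma feasible_direction_halfspaces:
  fixes a :: "'i \<Rightarrow> 'a::euclidean_space"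
  assumes "finite I"
    and x: "\<And>i. i \<in> I \<Longrightarrow> a i \<bullet> x \<le> b i"
    and v: "\<And>i. i \<in> I \<Longrightarrow> a i \<bullet> x = b i \<Longrightarrow> a i \<bullet> v \<le> 0"
  shows "\<forall>\<^sub>F t in at_right 0. \<forall>i\<in>I. a i \<bullet> (x + t *\<^sub>R v) \<le> b i"
proof (rule eventually_ball_finite[OF assms(1)], rule ballI)
  fix i assume i: "i \<in> I"
  show "\<forall>\<^sub>F t in at_right 0. a i \<bullet> (x + t *\<^sub>R v) \<le> b i"
  proof (cases "a i \<bullet> x = b i")
    case True
    have "a i \<bullet> (x + t *\<^sub>R v) \<le> b i" if "0 < t" for t
      using v[OF i True] True that by (simp add: inner_add_right mult_nonneg_nonpos)
    then show ?thesis
      by (auto intro: eventually_at_rightI[of 0 1])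
  next
    case False
    then have less: "a i \<bullet> x < b i"
      using x[OF i] by simp
    have "((\<lambda>t. a i \<bullet> (x + t *\<^sub>R v)) \<longlongrightarrow> a i \<bullet> (x + 0 *\<^sub>R v)) (at_right 0)"
      by (intro tendsto_intros)
    then have "\<forall>\<^sub>F t in at_right 0. a i \<bullet> (x + t *\<^sub>R v) < b i"
      by (rule order_tendstoD(2)) (use less in simp)
    then show ?thesis
      by (rule eventually_mono) simp
  qed
qed

lemma norm_decreases_along_descent_direction:
  fixes x v :: "'a::euclidean_space"
  assumes "v \<bullet> x < 0"
  shows "\<forall>\<^sub>F t in at_right 0. norm (x + t *\<^sub>R v) < norm x"
proof -
  have "((\<lambda>t. 2 * (v \<bullet> x) + t * (v \<bullet> v)) \<longlongrightarrow> 2 * (v \<bullet> x) + 0 * (v \<bullet> v)) (at_right 0)"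
    by (intro tendsto_intros)
  then have "\<forall>\<^sub>F t in at_right 0. 2 * (v \<bullet> x) + t * (v \<bullet> v) < 0"
    by (rule order_tendstoD(2)) (use assms in simp)
  moreover have "\<forall>\<^sub>F t in at_right (0::real). 0 < t"
    by (rule eventually_at_right_less)
  ultimately show ?thesis
  proof eventually_elim
    case (elim t)
    have "(x + t *\<^sub>R v) \<bullet> (x + t *\<^sub>R v) = x \<bullet> x + t * (2 * (v \<bullet> x) + t * (v \<bullet> v))"
      by (simp add: inner_add_left inner_add_right inner_commute algebra_simps)
    also have "\<dots> < x \<bullet> x"
      using elim by (simp add: mult_pos_neg)
    finally show ?case
      by (simp add: norm_eq_sqrt_inner)
  qed
qed

section \<open>Nearest points to a subspace as points of least norm\<close>

text \<open>
  The condition on \<open>z\<close> says that \<open>z - x\<close> is orthogonal to \<open>span S\<close>. On such \<open>z\<close> the squared distances to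
  \<open>0\<close> and to any \<open>u \<in> span S\<close> differ by a constant, so a point nearest to \<open>u\<close> in \<open>X\<close> has least norm.
  The converse has to produce \<open>u\<close>. If \<open>x\<close> were not a sum \<open>u + w\<close> with \<open>u \<in> span S\<close> and \<open>- w\<close> in the
  normal cone of \<open>X\<close> at \<open>x\<close>, Farkas' lemma would give a direction orthogonal to \<open>S\<close> along which \<open>x\<close> can
  move within \<open>X\<close> while its norm decreases.
\<close>

lemma closest_point_image_span:
  fixes X S :: "'a::euclidean_space set"
  assumes X: "polyhedron X" "X \<noteq> {}" and "finite S"
  shows "closest_point X ` span S =
    {x \<in> X. \<forall>z\<in>X. (\<forall>s\<in>S. s \<bullet> z = s \<bullet> x) \<longrightarrow> norm x \<le> norm z}"
    (is "?L = ?R")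
proof -
  have cl: "closed X" and cv: "convex X"
    using X by (auto simp: polyhedron_imp_closed polyhedron_imp_convex)
  show ?thesis
  proof (rule subset_antisym; rule subsetI)
    fix x assume "x \<in> ?L"
    then obtain u where u: "u \<in> span S" and x: "x = closest_point X u"
      by auto
    have "norm x \<le> norm z" if z: "z \<in> X" and eq: "\<forall>s\<in>S. s \<bullet> z = s \<bullet> x" for z
    proof -
      have "orthogonal (z - x) u"
        by (rule orthogonal_to_span[OF u])
          (use eq in \<open>auto simp: orthogonal_def inner_diff_left inner_diff_right inner_commute\<close>)
      then have uz: "z \<bullet> u = x \<bullet> u"
        by (simp add: orthogonal_def inner_diff_left)
      have "dist u x \<le> dist u z"
        unfolding x by (rule closest_point_le[OF cl z])
      then have "(u - x) \<bullet> (u - x) \<le> (u - z) \<bullet> (u - z)"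
        by (simp add: dist_norm norm_eq_sqrt_inner)
      then show ?thesis
        using uz by (simp add: inner_diff_left inner_diff_right inner_commute norm_eq_sqrt_inner)
    qed
    then show "x \<in> ?R"
      using closest_point_in_set[OF cl X(2)] by (auto simp: x)
  next
    fix x assume "x \<in> ?R"
    then have xX: "x \<in> X"
      and minimal: "\<And>z. z \<in> X \<Longrightarrow> (\<forall>s\<in>S. s \<bullet> z = s \<bullet> x) \<Longrightarrow> norm x \<le> norm z"
      by auto
    obtain F where "finite F" and F: "X = \<Inter>F"
      and "\<forall>h\<in>F. \<exists>a b. a \<noteq> 0 \<and> h = {z. a \<bullet> z \<le> b}"
      using X(1) unfolding polyhedron_def by blast
    then obtain a b where ab: "\<And>h. h \<in> F \<Longrightarrow> h = {z. a h \<bullet> z \<le> b h}"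
      by metis
    have X_iff: "z \<in> X \<longleftrightarrow> (\<forall>h\<in>F. a h \<bullet> z \<le> b h)" for z
      unfolding F using ab by blast
    \<comment> \<open>\<open>P\<close> generates \<open>span S\<close> as a cone, and \<open>N\<close> the negative of the normal cone of \<open>X\<close> at \<open>x\<close>.\<close>
    define P where "P = S \<union> uminus ` S"
    define N where "N = (\<lambda>h. - a h) ` {h \<in> F. a h \<bullet> x = b h}"
    have "x \<in> convex_cone hull (P \<union> N)"
    proof (rule ccontr)
      assume "x \<notin> convex_cone hull (P \<union> N)"
      moreover have "finite (P \<union> N)"
        using \<open>finite S\<close> \<open>finite F\<close> by (simp add: P_def N_def)
      ultimately obtain v where vx: "v \<bullet> x < 0" and v: "\<And>g. g \<in> P \<union> N \<Longrightarrow> 0 \<le> v \<bullet> g"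
        using farkas_convex_cone_hull by blast
      have vS: "s \<bullet> v = 0" if "s \<in> S" for s
        using v[of s] v[of "- s"] that by (simp add: P_def inner_commute)
      have va: "a h \<bullet> v \<le> 0" if "h \<in> F" "a h \<bullet> x = b h" for h
        using v[of "- a h"] that by (auto simp: N_def inner_commute)
      have "\<forall>\<^sub>F t in at_right 0. \<forall>h\<in>F. a h \<bullet> (x + t *\<^sub>R v) \<le> b h"
        using \<open>finite F\<close> xX va by (intro feasible_direction_halfspaces) (auto simp: X_iff)
      then have "\<forall>\<^sub>F t in at_right 0. (x + t *\<^sub>R v) \<in> X \<and> norm (x + t *\<^sub>R v) < norm x"
        using norm_decreases_along_descent_direction[OF vx] by eventually_elim (simp add: X_iff)
      then obtain t :: real where "x + t *\<^sub>R v \<in> X" "norm (x + t *\<^sub>R v) < norm x"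
        using eventually_happens trivial_limit_at_right_real by blast
      then show False
        using minimal[of "x + t *\<^sub>R v"] vS by (simp add: inner_add_right)
    qed
    then obtain u w where u: "u \<in> convex_cone hull P" and w: "w \<in> convex_cone hull N"
      and x: "x = u + w"
      by (auto simp: convex_cone_hull_Un)
    have "P \<subseteq> span S"
      by (auto simp: P_def span_base span_neg)
    then have "u \<in> span S"
      using u hull_minimal[of P "span S" convex_cone] convex_cone_span by blast
    moreover have "closest_point X u = x"
    proof (rule closest_point_unique[OF cv cl xX, symmetric], rule ballI)
      fix z assume z: "z \<in> X"
      have "N \<subseteq> {w. 0 \<le> (z - x) \<bullet> w}"
        using z by (auto simp: N_def X_iff inner_diff_left inner_diff_right inner_commute)
      then have "0 \<le> (z - x) \<bullet> w"
        using w hull_minimal[of N "{w. 0 \<le> (z - x) \<bullet> w}" convex_cone]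
          convex_cone_halfspace_ge by blast
      moreover have "(u - z) \<bullet> (u - z) = (u - x) \<bullet> (u - x) + 2 * ((z - x) \<bullet> w) + (z - x) \<bullet> (z - x)"
        unfolding x by (simp add: inner_diff_left inner_diff_right inner_add_left inner_add_right inner_commute)
      ultimately have "(u - x) \<bullet> (u - x) \<le> (u - z) \<bullet> (u - z)"
        using inner_ge_zero[of "z - x"] by linarith
      then show "dist u x \<le> dist u z"
        by (simp add: dist_norm norm_eq_sqrt_inner)
    qed
    ultimately show "x \<in> ?L"
      by blast
  qed
qed

section \<open>The box and the map gamma\<close>

lemma box_X_eq_cbox: "box_X = cbox (\<chi> i. -1) (\<chi> i. 1)"
  by (auto simp: box_X_def mem_box_cart)

lemma zero_in_box_X: "0 \<in> box_X"
  by (simp add: box_X_def)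

lemma uminus_image_box_X: "uminus ` box_X = (box_X :: (real ^ 'n) set)"
proof -
  have "- x \<in> box_X" if "x \<in> box_X" for x :: "real ^ 'n"
    using that by (fastforce simp: box_X_def)
  then show ?thesis
    by (metis (no_types, lifting) image_iff minus_minus subsetI subset_antisym)
qed

text \<open>
  For \<open>w\<close> in the fibre over \<open>y\<close> the inner product of \<open>transpose B *v y\<close> with \<open>w\<close> is
  \<open>y \<bullet> (B *v w) = y \<bullet> y\<close>, so the squared distance and the squared norm differ by a constant.
\<close>

lemma dist_least_norm_fibre:
  fixes B :: "real ^ 'n ^ 'm"
  assumes "B *v x = y" "B *v z = y"
  shows "dist (transpose B *v y) x \<le> dist (transpose B *v y) z \<longleftrightarrow> norm x \<le> norm z"
proof -
  let ?c = "transpose B *v y"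
  have c: "?c \<bullet> w = y \<bullet> (B *v w)" for w
    by (simp add: dot_lmul_matrix)
  have "dist ?c x \<le> dist ?c z \<longleftrightarrow> (?c - x) \<bullet> (?c - x) \<le> (?c - z) \<bullet> (?c - z)"
    by (simp add: dist_norm norm_eq_sqrt_inner)
  also have "\<dots> \<longleftrightarrow> x \<bullet> x \<le> z \<bullet> z"
    using c[of x] c[of z] assms
    by (simp add: inner_diff_left inner_diff_right inner_commute del: transpose_matrix_vector)
  finally show ?thesis
    by (simp add: norm_eq_sqrt_inner)
qed

text \<open>
  The constraint \<open>proj_A A x = transpose B *v y\<close> amounts to \<open>B *v x = y\<close>, as \<open>transpose B\<close> is injective.
  Stated as an equivalence, the lemma both gives the properties of \<open>gamma A B y\<close> and recognises a
  given point as this value.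
\<close>

lemma gamma_least_norm:
  fixes A :: "real ^ 'd ^ 'D" and B :: "real ^ 'D ^ 'd"
  assumes B: "rows_orthonormal_basis B (Ran A)" and y: "y \<in> set_Z B"
  shows "x = gamma A B y \<longleftrightarrow>
    x \<in> box_X \<and> B *v x = y \<and> (\<forall>z\<in>box_X. B *v z = y \<longrightarrow> norm x \<le> norm z)"
proof -
  have BB: "B ** transpose B = mat 1"
    using proj_A_matrix(1)[OF B] .
  have "proj_A A x = transpose B *v y \<longleftrightarrow> B *v x = y" for x
  proof
    assume "proj_A A x = transpose B *v y"
    then have "B *v (transpose B *v (B *v x)) = B *v (transpose B *v y)"
      by (simp only: proj_A_matrix(2)[OF B] matrix_vector_mul_assoc)
    then show "B *v x = y"
      by (simp only: matrix_vector_mul_assoc matrix_mul_assoc BB matrix_mul_lid matrix_vector_mul_lid)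
  next
    assume "B *v x = y"
    then show "proj_A A x = transpose B *v y"
      by (simp only: proj_A_matrix(2)[OF B] matrix_vector_mul_assoc[symmetric])
  qed
  then have g: "gamma A B y = closest_point (box_X \<inter> {x. B *v x = y}) (transpose B *v y)"
    (is "_ = closest_point ?K ?c")
    by (simp add: gamma_def)
  have "polyhedron ?K"
  proof -
    have "{x. B *v x = y} = \<Inter> ((\<lambda>i. {x. row i B \<bullet> x = y $ i}) ` UNIV)"
      by (auto simp: vec_eq_iff matrix_vector_mult_def row_def inner_vec_def)
    moreover have "polyhedron (\<Inter> ((\<lambda>i. {x. row i B \<bullet> x = y $ i}) ` UNIV))"
      by (rule polyhedron_Inter) (auto simp: polyhedron_hyperplane)
    ultimately show ?thesis
      by (simp add: box_X_eq_cbox)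
  qed
  then have cv: "convex ?K" and cl: "closed ?K"
    by (auto simp: polyhedron_imp_convex polyhedron_imp_closed)
  have ne: "?K \<noteq> {}"
    using y by (auto simp: set_Z_def)
  have "x = gamma A B y \<longleftrightarrow> x \<in> ?K \<and> (\<forall>z\<in>?K. dist ?c x \<le> dist ?c z)"
    unfolding g
    using closest_point_unique[OF cv cl] closest_point_exists[OF cl ne] by metis
  also have "\<dots> \<longleftrightarrow> x \<in> ?K \<and> (\<forall>z\<in>?K. norm x \<le> norm z)"
    using dist_least_norm_fibre by blast
  finally show ?thesis
    by auto
qed

lemma matrix_vector_mult_gamma:
  assumes "rows_orthonormal_basis B (Ran A)" "y \<in> set_Z B"
  shows "B *v gamma A B y = y"
  using gamma_least_norm[OF assms] by blast

text \<open>
  Both sides are the set of points of the box with least norm in their fibre of \<open>B\<close>.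
\<close>

lemma gamma_image_set_Z:
  fixes A :: "real ^ 'd ^ 'D" and B :: "real ^ 'D ^ 'd"
  assumes B: "rows_orthonormal_basis B (Ran A)"
  shows "gamma A B ` set_Z B = set_E A"
proof -
  have fibre: "(\<forall>r\<in>rows B. r \<bullet> z = r \<bullet> x) \<longleftrightarrow> B *v z = B *v x" for x z
    by (auto simp: rows_def vec_eq_iff matrix_vector_mult_def row_def inner_vec_def)
  have "set_E A = closest_point box_X ` span (rows B)"
    using B by (auto simp: set_E_def rows_orthonormal_basis_def Ran_def)
  also have "\<dots> = {x \<in> box_X. \<forall>z\<in>box_X. B *v z = B *v x \<longrightarrow> norm x \<le> norm z}"
  proof -
    have "polyhedron (box_X :: (real ^ 'D) set)" "(box_X :: (real ^ 'D) set) \<noteq> {}"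
      using zero_in_box_X by (auto simp: box_X_eq_cbox)
    moreover have "finite (rows B)"
      by (simp add: rows_def full_SetCompr_eq)
    ultimately show ?thesis
      by (rule closest_point_image_span[of box_X "rows B", unfolded fibre])
  qed
  also have "\<dots> = gamma A B ` set_Z B"
  proof -
    have "x \<in> gamma A B ` set_Z B \<longleftrightarrow> 
      x \<in> box_X \<and> (\<forall>z\<in>box_X. B *v z = B *v x \<longrightarrow> norm x \<le> norm z)" for x
      using gamma_least_norm[OF B, of _ x] by (auto simp: image_iff set_Z_def)
    then show ?thesis by blast
  qed
  finally show ?thesis by simp
qed

lemma set_Z_compact_convex_symmetric:
  shows "compact (set_Z B)" "convex (set_Z B)" "centrally_symmetric (set_Z B)"
proof -
  have lin: "linear ((*v) B)"
    by simp
  show "compact (set_Z B)" "convex (set_Z B)"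
    unfolding set_Z_def box_X_eq_cbox
    by (auto intro!: compact_continuous_image linear_continuous_on convex_linear_image
        simp: linear_conv_bounded_linear[symmetric])
  have "uminus ` set_Z B = (\<lambda>x. B *v x) ` (uminus ` box_X)"
    unfolding set_Z_def image_image by (simp add: linear_neg[OF lin])
  then show "centrally_symmetric (set_Z B)"
    by (simp add: centrally_symmetric_def uminus_image_box_X set_Z_def)
qed

theorem theorem2:
  fixes A :: "real ^ 'd ^ 'D" and B :: "real ^ 'D ^ 'd"
  assumes "CARD('d) \<le> CARD('D)"
    and "all_row_submatrices_invertible A"
    and "rows_orthonormal_basis B (Ran A)"
  shows "smallest_closed_set_with (\<lambda>Y. Y \<subseteq> set_Z B \<and> gamma A B ` Y = set_E A) (set_Z B)
    \<and> compact (set_Z B) \<and> convex (set_Z B) \<and> centrally_symmetric (set_Z B)"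
proof -
  have image: "gamma A B ` set_Z B = set_E A"
    by (rule gamma_image_set_Z[OF assms(3)])
  have "inj_on (gamma A B) (set_Z B)"
    by (rule inj_on_inverseI[where g = "\<lambda>x. B *v x"])
      (rule matrix_vector_mult_gamma[OF assms(3)])
  then have "Y = set_Z B" if "Y \<subseteq> set_Z B" "gamma A B ` Y = set_E A" for Y
    using that image by (metis inj_on_image_eq_iff order_refl)
  then show ?thesis
    using image set_Z_compact_convex_symmetric[of B]
    by (auto simp: smallest_closed_set_with_def compact_imp_closed)
qed

end
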